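(* Let $P,P_0,\dots,P_n\in\boldsymbol{B_1}$ with $n\ge1$, and let $f\in\boldsymbol{B_2}$. 1. If $P(x)\neq0$ for all $x\in[a,b]$, then ${\bf j}=P(x)-f(x,y)\theta(x-y)$, i.e. $({\bf j}\phi)(x)=P(x)\phi(x)-\int_a^xf(x,z)\phi(z)\,dz$, defines an invertible linear endomorphism of $C[a,b]$. 2. If $P_n(x)\neq0$ for all $x\in[a,b]$, then ${\bf k}=\sum_{i=1}^nP_i(x)\partial_x^i+P_0(x)+f(x,y)\theta(x-y)$, i.e. $({\bf k}\phi)(x)=\sum_{i=1}^nP_i(x)\partial_x^i\phi(x)+P_0(x)\phi(x)+\int_a^xf(x,z)\phi(z)\,dz$, defines an invertible linear operator from $D^n[a,b]$ to $C[a,b]$.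
   Context: Fix real numbers $a<b$. $\boldsymbol{B_1}$ is the algebra of smooth functions $[a,b]\to\mathbb C$. $\Delta=\{(x,y): a\le y\le x\le b\}$, and $\boldsymbol{B_2}$ is the algebra of smooth functions $\Delta\to\mathbb C$ (all partial derivatives of all orders exist and are continuous on $\Delta$). $C[a,b]$ is the space of continuous complex-valued functions on $[a,b]$. $D^n[a,b]$ is the space of $n$ times continuously differentiable functions $\phi:[a,b]\to\mathbb C$ such that $\partial_x^k\phi(a)=0$ for $k=0,\dots,n-1$. The symbol $f(x,y)\theta(x-y)$ denotes the Volterra operator $\phi\mapsto\int_a^xf(x,z)\phi(z)\,dz$. *)

theory Defs
  imports "HOL-Analysis.Analysis"
begin

subsection \<open>Functions on the interval\<close>

text \<open>
  Iterated derivative on \<open>[a,b]\<close>, one-sided at the endpoints.  Its values at points of \<open>[a,b]\<close>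
  depend only on the restriction of \<open>\<phi>\<close> to \<open>[a,b]\<close>; its values elsewhere are irrelevant.
\<close>

primrec Dx :: "real \<Rightarrow> real \<Rightarrow> nat \<Rightarrow> (real \<Rightarrow> complex) \<Rightarrow> real \<Rightarrow> complex" where
  "Dx a b 0 \<phi> = \<phi>"
| "Dx a b (Suc k) \<phi> = (\<lambda>x. vector_derivative (Dx a b k \<phi>) (at x within {a..b}))"

definition times_cont_diff :: "real \<Rightarrow> real \<Rightarrow> nat \<Rightarrow> (real \<Rightarrow> complex) \<Rightarrow> bool" where
  "times_cont_diff a b n \<phi> \<longleftrightarrow>
     (\<forall>k<n. \<forall>x\<in>{a..b}. Dx a b k \<phi> differentiable (at x within {a..b})) \<and>
     (\<forall>k\<le>n. continuous_on {a..b} (Dx a b k \<phi>))"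

definition B1 :: "real \<Rightarrow> real \<Rightarrow> (real \<Rightarrow> complex) set" where
  "B1 a b = {P. \<forall>n. times_cont_diff a b n P}"

text \<open>
  Elements of the function spaces are represented by total functions that vanish off \<open>[a,b]\<close>, so
  that each function on \<open>[a,b]\<close> has exactly one representative and the vector space operations
  are the pointwise ones.  No regularity across the endpoints is implied.
\<close>

definition C_space :: "real \<Rightarrow> real \<Rightarrow> (real \<Rightarrow> complex) set" where
  "C_space a b = {\<phi>. continuous_on {a..b} \<phi> \<and> (\<forall>x. x \<notin> {a..b} \<longrightarrow> \<phi> x = 0)}"

definition D_space :: "nat \<Rightarrow> real \<Rightarrow> real \<Rightarrow> (real \<Rightarrow> complex) set" where
  "D_space n a b =
     {\<phi>. times_cont_diff a b n \<phi> \<and> (\<forall>k<n. Dx a b k \<phi> a = 0) \<and> (\<forall>x. x \<notin> {a..b} \<longrightarrow> \<phi> x = 0)}"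


subsection \<open>Smooth functions on the triangle\<close>

definition triangle :: "real \<Rightarrow> real \<Rightarrow> (real \<times> real) set" where
  "triangle a b = {(x, y). a \<le> y \<and> y \<le> x \<and> x \<le> b}"

text \<open>
  All partial derivatives of order at most \<open>k\<close> exist and are continuous on the triangle.
  Partial derivatives are taken along the horizontal slice \<open>[y,b]\<close> and the vertical slice \<open>[a,x]\<close>,
  hence are one-sided on the boundary.  At \<open>(b,b)\<close> the horizontal slice, and at \<open>(a,a)\<close> the vertical
  slice, is a single point; there the derivative condition is void and the value of the
  partial derivative is the one determined by continuity.
\<close>

primrec Ck_triangle :: "real \<Rightarrow> real \<Rightarrow> nat \<Rightarrow> (real \<times> real \<Rightarrow> complex) \<Rightarrow> bool" where
  "Ck_triangle a b 0 f \<longleftrightarrow> continuous_on (triangle a b) f"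
| "Ck_triangle a b (Suc k) f \<longleftrightarrow>
     continuous_on (triangle a b) f \<and>
     (\<exists>fx fy.
        (\<forall>(x, y) \<in> triangle a b.
           ((\<lambda>s. f (s, y)) has_vector_derivative fx (x, y)) (at x within {y..b}) \<and>
           ((\<lambda>t. f (x, t)) has_vector_derivative fy (x, y)) (at y within {a..x})) \<and>
        Ck_triangle a b k fx \<and> Ck_triangle a b k fy)"

definition B2 :: "real \<Rightarrow> real \<Rightarrow> (real \<times> real \<Rightarrow> complex) set" where
  "B2 a b = {f. \<forall>k. Ck_triangle a b k f}"


subsection \<open>The operators\<close>

definition volterra ::
    "real \<Rightarrow> (real \<times> real \<Rightarrow> complex) \<Rightarrow> (real \<Rightarrow> complex) \<Rightarrow> real \<Rightarrow> complex" where
  "volterra a f \<phi> x = integral {a..x} (\<lambda>z. f (x, z) * \<phi> z)"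

definition j_op ::
    "real \<Rightarrow> real \<Rightarrow> (real \<Rightarrow> complex) \<Rightarrow> (real \<times> real \<Rightarrow> complex) \<Rightarrow>
     (real \<Rightarrow> complex) \<Rightarrow> real \<Rightarrow> complex" where
  "j_op a b P f \<phi> = (\<lambda>x. if x \<in> {a..b} then P x * \<phi> x - volterra a f \<phi> x else 0)"

definition k_op ::
    "real \<Rightarrow> real \<Rightarrow> nat \<Rightarrow> (nat \<Rightarrow> real \<Rightarrow> complex) \<Rightarrow> (real \<times> real \<Rightarrow> complex) \<Rightarrow>
     (real \<Rightarrow> complex) \<Rightarrow> real \<Rightarrow> complex" where
  "k_op a b n p f \<phi> =
     (\<lambda>x. if x \<in> {a..b}
          then (\<Sum>i=1..n. p i x * Dx a b i \<phi> x) + p 0 x * \<phi> x + volterra a f \<phi> x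
          else 0)"


subsection \<open>Invertible linear operators between function spaces\<close>

definition linear_map ::
    "(real \<Rightarrow> complex) set \<Rightarrow> (real \<Rightarrow> complex) set \<Rightarrow>
     ((real \<Rightarrow> complex) \<Rightarrow> (real \<Rightarrow> complex)) \<Rightarrow> bool" where
  "linear_map V W T \<longleftrightarrow>
     (\<forall>\<phi>\<in>V. T \<phi> \<in> W) \<and>
     (\<forall>\<phi>\<in>V. \<forall>\<psi>\<in>V. T (\<lambda>x. \<phi> x + \<psi> x) = (\<lambda>x. T \<phi> x + T \<psi> x)) \<and>
     (\<forall>c. \<forall>\<phi>\<in>V. T (\<lambda>x. c * \<phi> x) = (\<lambda>x. c * T \<phi> x))"

definition invertible_linear_map ::
    "(real \<Rightarrow> complex) set \<Rightarrow> (real \<Rightarrow> complex) set \<Rightarrow>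
     ((real \<Rightarrow> complex) \<Rightarrow> (real \<Rightarrow> complex)) \<Rightarrow> bool" where
  "invertible_linear_map V W T \<longleftrightarrow>
     linear_map V W T \<and>
     (\<exists>S. linear_map W V S \<and> (\<forall>\<phi>\<in>V. S (T \<phi>) = \<phi>) \<and> (\<forall>\<psi>\<in>W. T (S \<psi>) = \<psi>))"

end

theory Submission
  imports Defs
begin

text \<open>
  Volterra operators are small in the exponentially weighted norms
  \<open>\<parallel>u\<parallel>\<^sub>L = sup {norm (u z) * exp (- L * (z - a)) | z. z \<in> {a..b}}\<close>: their norm is \<open>O(1 / L)\<close>, because
  integrating \<open>exp (L * (z - a))\<close> from \<open>a\<close> gains a factor \<open>1 / L\<close>.  So for large \<open>L\<close> the equation
  \<open>u + T u = g\<close> is a contractive fixed point problem, and \<open>1 + T\<close> is a bijection of \<open>C[a,b]\<close>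
  (\<open>bij_betw_add_volterra_type\<close>).  This uses only the decay of the norm, which is stable under
  sums, multiplication by continuous functions and composition, so it is taken as the definition of
  an operator of Volterra type.  Multiplying by a function \<open>m\<close> without zeros shows that
  \<open>u \<mapsto> m u + T u\<close> is bijective for every \<open>T\<close> of Volterra type (\<open>second_kind_operator\<close>).

  The operator \<open>j\<close> has this form, with \<open>m = P\<close> and \<open>T\<close> the negative of the integral operator.  The
  operator \<open>k\<close> is brought to this form by taking the highest derivative as the unknown.
  Let \<open>J\<close> be integration from \<open>a\<close>.  By the fundamental theorem of calculus and the boundary conditions
  at \<open>a\<close>, the \<open>n\<close>-fold antiderivative \<open>J\<^sup>n\<close> is a linear bijection from \<open>C[a,b]\<close> to \<open>D\<^sup>n[a,b]\<close>
  (\<open>bij_betw_antideriv_power\<close>).  The substitution \<open>\<phi> = J\<^sup>n u\<close> turns \<open>\<partial>\<^sup>i \<phi>\<close> into \<open>J\<^sup>n\<^sup>-\<^sup>i u\<close>, whence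
  \<open>k (J\<^sup>n u) = P\<^sub>n u + T u\<close>, where \<open>T\<close> is a sum of terms each containing at least one integration and
  hence of Volterra type.
\<close>

section \<open>Linear maps between function spaces\<close>

lemma linear_mapD:
  assumes "linear_map V W T"
  shows "\<phi> \<in> V \<Longrightarrow> T \<phi> \<in> W"
    and "\<phi> \<in> V \<Longrightarrow> \<psi> \<in> V \<Longrightarrow> T (\<lambda>x. \<phi> x + \<psi> x) = (\<lambda>x. T \<phi> x + T \<psi> x)"
    and "\<phi> \<in> V \<Longrightarrow> T (\<lambda>x. c * \<phi> x) = (\<lambda>x. c * T \<phi> x)"
  using assms unfolding linear_map_def by blast+

lemma linear_map_comp:
  assumes "linear_map U V S" "linear_map V W T"
  shows "linear_map U W (T \<circ> S)"
  using assms unfolding linear_map_def by simp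

lemma invertible_linear_map_if_bij:
  assumes lin: "linear_map V W T" and bij: "bij_betw T V W"
    and add: "\<And>\<phi> \<psi>. \<phi> \<in> V \<Longrightarrow> \<psi> \<in> V \<Longrightarrow> (\<lambda>x. \<phi> x + \<psi> x) \<in> V"
    and scale: "\<And>c \<phi>. \<phi> \<in> V \<Longrightarrow> (\<lambda>x. c * \<phi> x) \<in> V"
  shows "invertible_linear_map V W T"
proof -
  define S where "S = inv_into V T"
  have S: "S \<psi> \<in> V" "T (S \<psi>) = \<psi>" if "\<psi> \<in> W" for \<psi>
    using bij that unfolding S_def
    by (simp_all add: bij_betw_imp_surj_on inv_into_into bij_betw_inv_into_right)
  have ST: "S (T \<phi>) = \<phi>" if "\<phi> \<in> V" for \<phi>
    using bij that unfolding S_def by (metis bij_betw_inv_into_left)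
  have "linear_map W V S"
    unfolding linear_map_def
  proof (intro conjI ballI allI)
    fix \<phi> \<psi> assume "\<phi> \<in> W" "\<psi> \<in> W"
    then show "S (\<lambda>x. \<phi> x + \<psi> x) = (\<lambda>x. S \<phi> x + S \<psi> x)"
      using ST[OF add[of "S \<phi>" "S \<psi>"]] linear_mapD(2)[OF lin, of "S \<phi>" "S \<psi>"] by (simp add: S)
  next
    fix c \<phi> assume "\<phi> \<in> W"
    then show "S (\<lambda>x. c * \<phi> x) = (\<lambda>x. c * S \<phi> x)"
      using ST[OF scale[of "S \<phi>" c]] linear_mapD(3)[OF lin, of "S \<phi>" c] by (simp add: S)
  qed (rule S)
  then show ?thesis
    unfolding invertible_linear_map_def using lin S ST by blast
qed

text \<open>
  A linear parametrisation \<open>J\<close> of the domain reduces invertibility of \<open>T\<close> to that of \<open>T \<circ> J\<close>.  Linearity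
  of \<open>T\<close> and closure of \<open>V\<close> under the vector space operations are transported as well, so nothing
  has to be checked on \<open>V\<close> itself.
\<close>

lemma invertible_linear_map_if_parametrised:
  assumes J: "linear_map U V J" "bij_betw J U V"
    and G: "linear_map U W G" "bij_betw G U W"
    and add: "\<And>u v. u \<in> U \<Longrightarrow> v \<in> U \<Longrightarrow> (\<lambda>x. u x + v x) \<in> U"
    and scale: "\<And>c u. u \<in> U \<Longrightarrow> (\<lambda>x. c * u x) \<in> U"
    and T: "\<And>u. u \<in> U \<Longrightarrow> T (J u) = G u"
  shows "invertible_linear_map V W T"
proof (rule invertible_linear_map_if_bij)
  have V: "V = J ` U"
    using J(2) by (simp add: bij_betw_def)
  have J_add: "(\<lambda>x. J u x + J v x) = J (\<lambda>x. u x + v x)" if "u \<in> U" "v \<in> U" for u v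
    using linear_mapD(2)[OF J(1) that] by simp
  have J_scale: "(\<lambda>x. c * J u x) = J (\<lambda>x. c * u x)" if "u \<in> U" for c u
    using linear_mapD(3)[OF J(1) that] by simp
  show "(\<lambda>x. \<phi> x + \<psi> x) \<in> V" if "\<phi> \<in> V" "\<psi> \<in> V" for \<phi> \<psi>
    using that add J_add unfolding V by blast
  show "(\<lambda>x. c * \<phi> x) \<in> V" if "\<phi> \<in> V" for c \<phi>
    using that scale J_scale unfolding V by blast
  show "linear_map V W T"
    unfolding linear_map_def V
    by (auto simp: J_add J_scale T add scale linear_mapD[OF G(1)])
  have "bij_betw (T \<circ> J) U W"
    using G(2) T by (simp cong: bij_betw_cong)
  then show "bij_betw T V W"
    using bij_betw_comp_iff[OF J(2)] by blast
qed

section \<open>The spaces of continuous functions\<close>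

text \<open>The representative, in the sense of \<^const>\<open>C_space\<close>, of the restriction of \<open>\<phi>\<close> to \<open>[a,b]\<close>.\<close>

definition truncate :: "real \<Rightarrow> real \<Rightarrow> (real \<Rightarrow> complex) \<Rightarrow> real \<Rightarrow> complex" where
  "truncate a b \<phi> = (\<lambda>x. if x \<in> {a..b} then \<phi> x else 0)"

lemma truncate_in [simp]: "x \<in> {a..b} \<Longrightarrow> truncate a b \<phi> x = \<phi> x"
  and truncate_out [simp]: "x \<notin> {a..b} \<Longrightarrow> truncate a b \<phi> x = 0"
  by (auto simp: truncate_def)

lemma truncate_in_C_space_iff: "truncate a b \<phi> \<in> C_space a b \<longleftrightarrow> continuous_on {a..b} \<phi>"
proof -
  have "continuous_on {a..b} (truncate a b \<phi>) \<longleftrightarrow> continuous_on {a..b} \<phi>"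
    by (rule continuous_on_cong) auto
  then show ?thesis
    unfolding C_space_def using truncate_out by blast
qed

lemma C_spaceD:
  assumes "u \<in> C_space a b"
  shows "continuous_on {a..b} u" and "x \<notin> {a..b} \<Longrightarrow> u x = 0"
  using assms by (auto simp: C_space_def)

lemma C_space_eqI:
  assumes "u \<in> C_space a b" "v \<in> C_space a b" "\<And>x. x \<in> {a..b} \<Longrightarrow> u x = v x"
  shows "u = v"
  using assms by (metis C_spaceD(2) ext)

lemma C_space_add: "u \<in> C_space a b \<Longrightarrow> v \<in> C_space a b \<Longrightarrow> (\<lambda>x. u x + v x) \<in> C_space a b"
  and C_space_diff: "u \<in> C_space a b \<Longrightarrow> v \<in> C_space a b \<Longrightarrow> (\<lambda>x. u x - v x) \<in> C_space a b"
  and C_space_scale: "u \<in> C_space a b \<Longrightarrow> (\<lambda>x. c * u x) \<in> C_space a b"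
  and C_space_zero: "(\<lambda>x. 0) \<in> C_space a b"
  by (auto simp: C_space_def intro!: continuous_intros)

lemma C_space_mult:
  "continuous_on {a..b} m \<Longrightarrow> u \<in> C_space a b \<Longrightarrow> (\<lambda>x. m x * u x) \<in> C_space a b"
  by (auto simp: C_space_def intro!: continuous_intros)

lemma bij_betw_mult_C_space:
  assumes "continuous_on {a..b} m" "\<And>x. x \<in> {a..b} \<Longrightarrow> m x \<noteq> 0"
  shows "bij_betw (\<lambda>u x. m x * u x) (C_space a b) (C_space a b)"
proof (rule bij_betw_byWitness)
  have inv: "continuous_on {a..b} (\<lambda>x. inverse (m x))"
    using assms by (intro continuous_intros) auto
  show "(\<lambda>u x. inverse (m x) * u x) ` C_space a b \<subseteq> C_space a b"
    using C_space_mult[OF inv] by blast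
  show "(\<lambda>u x. m x * u x) ` C_space a b \<subseteq> C_space a b"
    using C_space_mult[OF assms(1)] by blast
  show "\<forall>u\<in>C_space a b. (\<lambda>x. inverse (m x) * (m x * u x)) = u"
    and "\<forall>u\<in>C_space a b. (\<lambda>x. m x * (inverse (m x) * u x)) = u"
    using assms(2) C_spaceD(2) by (fastforce simp: fun_eq_iff)+
qed

lemma linear_map_diff:
  assumes "linear_map (C_space a b) W T" "u \<in> C_space a b" "v \<in> C_space a b"
  shows "T (\<lambda>x. u x - v x) = (\<lambda>x. T u x - T v x)"
  using linear_mapD(2)[OF assms(1,2) C_space_scale[OF assms(3), of "-1"]]
    linear_mapD(3)[OF assms(1,3), of "-1"] by simp

section \<open>Operators of Volterra type\<close>

text \<open>
  The bound says that the operator norm of \<open>T\<close> with respect to the weight \<open>exp (- L * (x - a))\<close>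
  is at most \<open>M / L\<close>, with one constant \<open>M\<close> for all \<open>L \<ge> 1\<close>.  The norm is expressed through upper
  bounds \<open>c\<close> rather than as a supremum, so that bounds can be passed on directly.
\<close>

definition volterra_type ::
    "real \<Rightarrow> real \<Rightarrow> ((real \<Rightarrow> complex) \<Rightarrow> real \<Rightarrow> complex) \<Rightarrow> bool" where
  "volterra_type a b T \<longleftrightarrow> linear_map (C_space a b) (C_space a b) T \<and>
     (\<exists>M\<ge>0. \<forall>L\<ge>1. \<forall>c. \<forall>u\<in>C_space a b.
        (\<forall>z\<in>{a..b}. norm (u z) \<le> c * exp (L * (z - a))) \<longrightarrow>
        (\<forall>x\<in>{a..b}. norm (T u x) \<le> M / L * c * exp (L * (x - a))))"

text \<open>The constant \<open>c\<close> may be taken nonnegative, since it bounds a norm up to a positive factor.\<close>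

lemma volterra_typeI:
  assumes "linear_map (C_space a b) (C_space a b) T" "M \<ge> 0"
    and "\<And>L c u x. \<lbrakk>L \<ge> 1; u \<in> C_space a b; \<And>z. z \<in> {a..b} \<Longrightarrow> norm (u z) \<le> c * exp (L * (z - a));
           x \<in> {a..b}; c \<ge> 0\<rbrakk> \<Longrightarrow> norm (T u x) \<le> M / L * c * exp (L * (x - a))"
  shows "volterra_type a b T"
  unfolding volterra_type_def
proof (intro conjI exI allI impI ballI)
  fix L c :: real and u x
  assume *: "1 \<le> L" "u \<in> C_space a b" "\<forall>z\<in>{a..b}. norm (u z) \<le> c * exp (L * (z - a))" "x \<in> {a..b}"
  have "0 \<le> c * exp (L * (x - a))"
    using *(3,4) norm_ge_zero order_trans by blast
  then have "c \<ge> 0"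
    by (simp add: zero_le_mult_iff)
  then show "norm (T u x) \<le> M / L * c * exp (L * (x - a))"
    using * assms(3) by blast
qed (use assms in auto)

lemma volterra_typeE:
  assumes "volterra_type a b T"
  obtains M where "M \<ge> 0"
    and "\<And>L c u x. \<lbrakk>L \<ge> 1; u \<in> C_space a b; \<And>z. z \<in> {a..b} \<Longrightarrow> norm (u z) \<le> c * exp (L * (z - a));
           x \<in> {a..b}\<rbrakk> \<Longrightarrow> norm (T u x) \<le> M / L * c * exp (L * (x - a))"
  using assms unfolding volterra_type_def by blast

lemma volterra_type_linear: "volterra_type a b T \<Longrightarrow> linear_map (C_space a b) (C_space a b) T"
  by (simp add: volterra_type_def)

lemma volterra_type_zero: "volterra_type a b (\<lambda>u x. 0)"
  by (rule volterra_typeI[where M = 0]) (auto simp: linear_map_def C_space_zero)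

lemma volterra_type_add:
  assumes "volterra_type a b S" "volterra_type a b T"
  shows "volterra_type a b (\<lambda>u x. S u x + T u x)"
proof -
  note lin = assms[THEN volterra_type_linear]
  obtain M where M: "M \<ge> 0"
    "\<And>L c u x. \<lbrakk>L \<ge> 1; u \<in> C_space a b; \<And>z. z \<in> {a..b} \<Longrightarrow> norm (u z) \<le> c * exp (L * (z - a));
       x \<in> {a..b}\<rbrakk> \<Longrightarrow> norm (S u x) \<le> M / L * c * exp (L * (x - a))"
    using volterra_typeE[OF assms(1)] by metis
  obtain N where N: "N \<ge> 0"
    "\<And>L c u x. \<lbrakk>L \<ge> 1; u \<in> C_space a b; \<And>z. z \<in> {a..b} \<Longrightarrow> norm (u z) \<le> c * exp (L * (z - a));
       x \<in> {a..b}\<rbrakk> \<Longrightarrow> norm (T u x) \<le> N / L * c * exp (L * (x - a))"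
    using volterra_typeE[OF assms(2)] by metis
  show ?thesis
  proof (rule volterra_typeI[where M = "M + N"])
    show "linear_map (C_space a b) (C_space a b) (\<lambda>u x. S u x + T u x)"
      using lin unfolding linear_map_def
      by (auto simp: algebra_simps intro: C_space_add)
  next
    fix L c u x
    assume *: "L \<ge> 1" "u \<in> C_space a b" "\<And>z. z \<in> {a..b} \<Longrightarrow> norm (u z) \<le> c * exp (L * (z - a))"
      "x \<in> {a..b}"
    have "norm (S u x + T u x) \<le> M / L * c * exp (L * (x - a)) + N / L * c * exp (L * (x - a))"
      using M(2)[OF *] N(2)[OF *] norm_triangle_mono by blast
    then show "norm (S u x + T u x) \<le> (M + N) / L * c * exp (L * (x - a))"
      by (simp add: algebra_simps add_divide_distrib)
  qed (use M N in auto)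
qed

lemma volterra_type_sum:
  assumes "finite I" "\<And>i. i \<in> I \<Longrightarrow> volterra_type a b (T i)"
  shows "volterra_type a b (\<lambda>u x. \<Sum>i\<in>I. T i u x)"
  using assms
proof (induction I rule: finite_induct)
  case empty
  then show ?case by (simp add: volterra_type_zero)
next
  case (insert i I)
  then show ?case by (simp add: volterra_type_add)
qed

lemma volterra_type_mult:
  assumes m: "continuous_on {a..b} m" and T: "volterra_type a b T"
  shows "volterra_type a b (\<lambda>u x. m x * T u x)"
proof -
  note lin = T[THEN volterra_type_linear]
  obtain M where M: "M \<ge> 0"
    "\<And>L c u x. \<lbrakk>L \<ge> 1; u \<in> C_space a b; \<And>z. z \<in> {a..b} \<Longrightarrow> norm (u z) \<le> c * exp (L * (z - a));
       x \<in> {a..b}\<rbrakk> \<Longrightarrow> norm (T u x) \<le> M / L * c * exp (L * (x - a))"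
    using volterra_typeE[OF T] by metis
  have "bounded (m ` {a..b})"
    by (intro compact_imp_bounded compact_continuous_image m compact_Icc)
  then obtain B where B: "B > 0" "\<And>x. x \<in> {a..b} \<Longrightarrow> norm (m x) \<le> B"
    unfolding bounded_pos by auto
  show ?thesis
  proof (rule volterra_typeI[where M = "B * M"])
    show "linear_map (C_space a b) (C_space a b) (\<lambda>u x. m x * T u x)"
      using lin unfolding linear_map_def
      by (auto simp: algebra_simps intro: C_space_mult[OF m])
  next
    fix L c u x
    assume *: "L \<ge> 1" "u \<in> C_space a b" "\<And>z. z \<in> {a..b} \<Longrightarrow> norm (u z) \<le> c * exp (L * (z - a))"
      "x \<in> {a..b}"
    have "norm (m x * T u x) \<le> B * (M / L * c * exp (L * (x - a)))"
      unfolding norm_mult using B M(2)[OF *] *(4) by (intro mult_mono) auto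
    then show "norm (m x * T u x) \<le> B * M / L * c * exp (L * (x - a))"
      by (simp add: mult.assoc)
  qed (use M B in auto)
qed

lemma volterra_type_comp:
  assumes S: "volterra_type a b S" and T: "volterra_type a b T"
  shows "volterra_type a b (\<lambda>u. T (S u))"
proof -
  note lin = assms[THEN volterra_type_linear]
  obtain M where M: "M \<ge> 0"
    "\<And>L c u x. \<lbrakk>L \<ge> 1; u \<in> C_space a b; \<And>z. z \<in> {a..b} \<Longrightarrow> norm (u z) \<le> c * exp (L * (z - a));
       x \<in> {a..b}\<rbrakk> \<Longrightarrow> norm (S u x) \<le> M / L * c * exp (L * (x - a))"
    using volterra_typeE[OF S] by metis
  obtain N where N: "N \<ge> 0"
    "\<And>L c u x. \<lbrakk>L \<ge> 1; u \<in> C_space a b; \<And>z. z \<in> {a..b} \<Longrightarrow> norm (u z) \<le> c * exp (L * (z - a));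
       x \<in> {a..b}\<rbrakk> \<Longrightarrow> norm (T u x) \<le> N / L * c * exp (L * (x - a))"
    using volterra_typeE[OF T] by metis
  show ?thesis
  proof (rule volterra_typeI[where M = "N * M"])
    show "linear_map (C_space a b) (C_space a b) (\<lambda>u. T (S u))"
      using linear_map_comp[OF lin] by (simp add: comp_def)
  next
    fix L c :: real and u x
    assume *: "L \<ge> 1" "u \<in> C_space a b" "\<And>z. z \<in> {a..b} \<Longrightarrow> norm (u z) \<le> c * exp (L * (z - a))"
      and x: "x \<in> {a..b}" and "c \<ge> 0"
    have "norm (T (S u) x) \<le> N / L * (M / L * c) * exp (L * (x - a))"
      using *(1) linear_mapD(1)[OF lin(1) *(2)] M(2)[OF *] x by (rule N(2))
    also have "\<dots> = (N * M / L * c * exp (L * (x - a))) / L"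
      by simp
    also have "\<dots> \<le> N * M / L * c * exp (L * (x - a))"
      \<comment> \<open>the second factor \<open>1 / L\<close> is at most \<open>1\<close>\<close>
      using \<open>L \<ge> 1\<close> \<open>c \<ge> 0\<close> M(1) N(1) by (intro divide_left_mono[of 1 L, simplified]) auto
    finally show "norm (T (S u) x) \<le> N * M / L * c * exp (L * (x - a))" .
  qed (use M N in auto)
qed

text \<open>
  The fixed point is taken in the Banach space of bounded continuous functions on the whole real line,
  with \<open>u \<in> C[a,b]\<close> represented by \<open>exp (- L * (x - a)) * u x\<close>, continued by constants outside \<open>[a,b]\<close>.
  The supremum norm of the representative is the weighted norm of \<open>u\<close>.
\<close>

lemma bij_betw_add_volterra_type:
  assumes "a < b" and T: "volterra_type a b T"
  shows "bij_betw (\<lambda>u x. u x + T u x) (C_space a b) (C_space a b)"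
proof -
  note lin = T[THEN volterra_type_linear]
  obtain M where M: "M \<ge> 0"
    "\<And>L c u x. \<lbrakk>L \<ge> 1; u \<in> C_space a b; \<And>z. z \<in> {a..b} \<Longrightarrow> norm (u z) \<le> c * exp (L * (z - a));
       x \<in> {a..b}\<rbrakk> \<Longrightarrow> norm (T u x) \<le> M / L * c * exp (L * (x - a))"
    using volterra_typeE[OF T] by metis
  \<comment> \<open>large enough for \<open>T\<close> to have weighted norm at most \<open>1 / 2\<close>\<close>
  define L where "L = 2 * M + 1"
  have L: "L \<ge> 1" "M / L \<le> 1 / 2"
    using M(1) by (auto simp: L_def field_simps)
  define clip where "clip x = max a (min b x)" for x :: real
  have clip: "clip x \<in> {a..b}" "x \<in> {a..b} \<Longrightarrow> clip x = x" for x
    using \<open>a < b\<close> by (auto simp: clip_def)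
  \<comment> \<open>\<open>R\<close> sends a function to its representative; \<open>E\<close> is a left inverse of \<open>R\<close> but not a right inverse, as
    bounded functions need not be constant outside \<open>[a,b]\<close>\<close>
  define E :: "(real \<Rightarrow>\<^sub>C complex) \<Rightarrow> real \<Rightarrow> complex" where
    "E w = truncate a b (\<lambda>x. complex_of_real (exp (L * (x - a))) * apply_bcontfun w x)" for w
  define R :: "(real \<Rightarrow> complex) \<Rightarrow> (real \<Rightarrow>\<^sub>C complex)" where
    "R u = Bcontfun (\<lambda>x. complex_of_real (exp (- L * (clip x - a))) * u (clip x))" for u
  have E_in: "E w \<in> C_space a b" for w
    unfolding E_def truncate_in_C_space_iff
    by (intro continuous_intros continuous_on_apply_bcontfun)
  have apply_R: "apply_bcontfun (R u) x = complex_of_real (exp (- L * (clip x - a))) * u (clip x)"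
    if u: "u \<in> C_space a b" for u x
  proof -
    let ?h = "\<lambda>x. complex_of_real (exp (- L * (x - a))) * u x"
    have h: "continuous_on {a..b} ?h"
      using C_spaceD(1)[OF u] by (intro continuous_intros)
    have "continuous_on UNIV (?h \<circ> clip)"
    proof (rule continuous_on_compose)
      show "continuous_on UNIV clip"
        unfolding clip_def by (intro continuous_intros)
      show "continuous_on (range clip) ?h"
        by (rule continuous_on_subset[OF h]) (use clip(1) in auto)
    qed
    moreover have "bounded (range (?h \<circ> clip))"
      by (rule bounded_subset[OF compact_imp_bounded[OF compact_continuous_image[OF h compact_Icc]]])
        (use clip(1) in auto)
    ultimately show ?thesis
      unfolding R_def by (subst Bcontfun_inverse) (auto simp: bcontfun_def comp_def)
  qed
  have ER: "E (R u) = u" if u: "u \<in> C_space a b" for u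
  proof (rule C_space_eqI[OF E_in u])
    fix x assume "x \<in> {a..b}"
    then show "E (R u) x = u x"
      by (simp add: E_def apply_R[OF u] clip mult.assoc[symmetric] flip: of_real_mult exp_add)
  qed
  have ex1: "\<exists>!u. u \<in> C_space a b \<and> (\<lambda>x. u x + T u x) = g" if g: "g \<in> C_space a b" for g
  proof -
    define F where "F w = R (\<lambda>x. g x - T (E w) x)" for w
    have F_in: "(\<lambda>x. g x - T (E w) x) \<in> C_space a b" for w
      by (intro C_space_diff g linear_mapD(1)[OF lin] E_in)
    have "dist (F w) (F w') \<le> 1 / 2 * dist w w'" for w w'
    proof (rule dist_bound)
      fix x
      let ?y = "clip x" and ?d = "\<lambda>x. E w x - E w' x"
      have "norm (?d z) \<le> dist w w' * exp (L * (z - a))" if "z \<in> {a..b}" for z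
      proof -
        have "?d z = complex_of_real (exp (L * (z - a))) * (apply_bcontfun w z - apply_bcontfun w' z)"
          using that by (simp add: E_def right_diff_distrib)
        then have "norm (?d z) = exp (L * (z - a)) * dist (apply_bcontfun w z) (apply_bcontfun w' z)"
          by (simp add: norm_mult dist_norm)
        also have "\<dots> \<le> exp (L * (z - a)) * dist w w'"
          by (intro mult_left_mono dist_bounded) auto
        finally show ?thesis
          by (simp add: mult.commute)
      qed
      then have "norm (T ?d ?y) \<le> M / L * dist w w' * exp (L * (?y - a))"
        by (intro M(2) L C_space_diff E_in clip(1))
      also have "\<dots> \<le> 1 / 2 * dist w w' * exp (L * (?y - a))"
        using L by (intro mult_right_mono) auto
      finally have *: "norm (T ?d ?y) \<le> 1 / 2 * dist w w' * exp (L * (?y - a))" .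
      have "dist (F w x) (F w' x) = exp (- L * (?y - a)) * norm (T ?d ?y)"
        unfolding F_def apply_R[OF F_in] linear_map_diff[OF lin E_in E_in] dist_norm
        by (simp add: norm_mult norm_minus_commute flip: right_diff_distrib)
      also have "\<dots> \<le> exp (- L * (?y - a)) * (1 / 2 * dist w w' * exp (L * (?y - a)))"
        using * by (intro mult_left_mono) auto
      also have "\<dots> = 1 / 2 * dist w w'"
      proof -
        have "exp (- L * (?y - a)) * exp (L * (?y - a)) = 1"
          by (simp flip: exp_add)
        then show ?thesis
          by (simp only: mult.left_commute[of "exp (- L * (?y - a))"] mult_1_right)
      qed
      finally show "dist (F w x) (F w' x) \<le> 1 / 2 * dist w w'" .
    qed
    then have "\<exists>!w. F w = w"
      by (intro banach_fix_type[of "1 / 2"]) auto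
    then obtain w where w: "F w = w" and unique: "\<And>w'. F w' = w' \<Longrightarrow> w' = w"
      by blast
    show ?thesis
    proof (rule ex1I)
      have "E (F w) = (\<lambda>x. g x - T (E w) x)"
        unfolding F_def by (rule ER[OF F_in])
      then have "E w x = g x - T (E w) x" for x
        unfolding w by (rule fun_cong)
      then have "E w x + T (E w) x = g x" for x
        by (metis diff_add_cancel)
      then show "E w \<in> C_space a b \<and> (\<lambda>x. E w x + T (E w) x) = g"
        using E_in by blast
    next
      fix u assume u: "u \<in> C_space a b \<and> (\<lambda>x. u x + T u x) = g"
      then have "(\<lambda>x. g x - T u x) = u"
        by auto
      then have "F (R u) = R u"
        using u by (simp add: F_def ER)
      then show "u = E w"
        using unique ER u by metis
    qed
  qed
  show ?thesis
  proof (rule bij_betwI')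
    fix u v assume "u \<in> C_space a b" "v \<in> C_space a b"
    then show "((\<lambda>x. u x + T u x) = (\<lambda>x. v x + T v x)) = (u = v)"
      using ex1[of "\<lambda>x. v x + T v x"] C_space_add linear_mapD(1)[OF lin] by metis
  next
    fix u assume "u \<in> C_space a b"
    then show "(\<lambda>x. u x + T u x) \<in> C_space a b"
      by (intro C_space_add linear_mapD(1)[OF lin])
  next
    fix g assume "g \<in> C_space a b"
    then show "\<exists>u\<in>C_space a b. g = (\<lambda>x. u x + T u x)"
      using ex1 by metis
  qed
qed

section \<open>Volterra integral operators\<close>

definition volterra_op ::
    "real \<Rightarrow> real \<Rightarrow> (real \<times> real \<Rightarrow> complex) \<Rightarrow> (real \<Rightarrow> complex) \<Rightarrow> real \<Rightarrow> complex" where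
  "volterra_op a b f u = truncate a b (volterra a f u)"

lemma continuous_on_volterra_integrand:
  fixes f :: "real \<times> real \<Rightarrow> complex"
  assumes "continuous_on (triangle a b) f" "continuous_on {a..b} u" "x \<in> {a..b}"
  shows "continuous_on {a..x} (\<lambda>z. f (x, z) * u z)"
proof (intro continuous_intros)
  show "continuous_on {a..x} u"
    using assms by (auto intro: continuous_on_subset)
  show "continuous_on {a..x} (\<lambda>z. f (x, z))"
    by (rule continuous_on_compose2[OF assms(1)])
      (use assms(3) in \<open>auto simp: triangle_def intro!: continuous_intros\<close>)
qed

text \<open>
  The substitution \<open>z = a + t * (x - a)\<close> turns the integral into one over the fixed interval \<open>[0,1]\<close>.
  Its integrand is jointly continuous in \<open>x\<close> and \<open>t\<close> because the points \<open>(x, a + t * (x - a))\<close> stay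
  in the triangle.
\<close>

lemma continuous_on_volterra:
  assumes f: "continuous_on (triangle a b) f" and u: "continuous_on {a..b} u"
  shows "continuous_on {a..b} (volterra a f u)"
proof -
  let ?h = "\<lambda>x t. (x - a) *\<^sub>R (f (x, a + t * (x - a)) * u (a + t * (x - a)))"
  have le: "t * (x - a) \<le> x - a" if "0 \<le> t" "t \<le> 1" "a \<le> x" for t x
    using that mult_right_mono[of t 1 "x - a"] by simp
  have "continuous_on ({a..b} \<times> cbox 0 1) (\<lambda>(x, t). ?h x t)"
    unfolding case_prod_unfold
  proof (intro continuous_intros)
    show "continuous_on ({a..b} \<times> cbox 0 1) (\<lambda>q. f (fst q, a + snd q * (fst q - a)))"
      by (rule continuous_on_compose2[OF f])
        (use le in \<open>force simp: triangle_def intro!: continuous_intros\<close>)+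
    show "continuous_on ({a..b} \<times> cbox 0 1) (\<lambda>q. u (a + snd q * (fst q - a)))"
    proof (rule continuous_on_compose2[OF u])
      show "(\<lambda>q. a + snd q * (fst q - a)) ` ({a..b} \<times> cbox 0 1) \<subseteq> {a..b}"
        using le by (force simp: mult_nonneg_nonneg)
    qed (intro continuous_intros)
  qed
  then have "continuous_on {a..b} (\<lambda>x. integral (cbox 0 1) (?h x))"
    by (intro integral_continuous_on_param) (simp add: split_def)
  moreover have "integral (cbox 0 1) (?h x) = volterra a f u x" if x: "x \<in> {a..b}" for x
  proof -
    have "((\<lambda>t. (x - a) *\<^sub>R (f (x, a + t * (x - a)) * u (a + t * (x - a)))) has_integral
        integral {a + 0 * (x - a)..a + 1 * (x - a)} (\<lambda>z. f (x, z) * u z)) {0..1}"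
    proof (rule has_integral_substitution[where c = a and d = x])
      show "(\<lambda>t. a + t * (x - a)) ` {0..1} \<subseteq> {a..x}"
        using le x by (force simp: mult_nonneg_nonneg)
    qed (use x continuous_on_volterra_integrand[OF f u x] in
          \<open>auto intro!: derivative_eq_intros\<close>)
    then have "(?h x has_integral volterra a f u x) {0..1}"
      unfolding volterra_def by simp
    then show ?thesis
      unfolding cbox_interval by (rule integral_unique)
  qed
  ultimately show ?thesis
    by (subst continuous_on_cong[OF refl, symmetric])
qed

lemma integrable_volterra_integrand:
  assumes "continuous_on (triangle a b) f" "u \<in> C_space a b" "x \<in> {a..b}"
  shows "(\<lambda>z. f (x, z) * u z) integrable_on {a..x}"
  using continuous_on_volterra_integrand[OF assms(1) C_spaceD(1)[OF assms(2)] assms(3)]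
  by (rule integrable_continuous_real)

lemma compact_triangle: "compact (triangle a b)"
proof -
  have "triangle a b = ({a..b} \<times> {a..b}) \<inter> {p. snd p \<le> fst p}"
    by (auto simp: triangle_def)
  then show ?thesis
    by (auto intro!: compact_Int_closed compact_Times closed_Collect_le continuous_intros)
qed

text \<open>
  If \<open>f\<close> is bounded by \<open>M\<close> and \<open>u\<close> by \<open>c * exp (L * (z - a))\<close>, then the integral is bounded by
  \<open>M * c * (exp (L * (x - a)) - 1) / L\<close>.
\<close>

lemma volterra_type_volterra_op:
  assumes f: "continuous_on (triangle a b) f"
  shows "volterra_type a b (volterra_op a b f)"
proof -
  have "bounded (f ` triangle a b)"
    by (intro compact_imp_bounded compact_continuous_image f compact_triangle)
  then obtain M where M: "M > 0" "\<And>p. p \<in> triangle a b \<Longrightarrow> norm (f p) \<le> M"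
    unfolding bounded_pos by auto
  note int = integrable_volterra_integrand[OF f]
  show ?thesis
  proof (rule volterra_typeI[where M = M])
    show "linear_map (C_space a b) (C_space a b) (volterra_op a b f)"
      unfolding linear_map_def
    proof (intro conjI ballI allI)
      fix u assume "u \<in> C_space a b"
      then show "volterra_op a b f u \<in> C_space a b"
        by (simp add: volterra_op_def truncate_in_C_space_iff continuous_on_volterra[OF f] C_spaceD)
    next
      fix u v assume "u \<in> C_space a b" "v \<in> C_space a b"
      then show "volterra_op a b f (\<lambda>x. u x + v x) = (\<lambda>x. volterra_op a b f u x + volterra_op a b f v x)"
        by (auto simp: volterra_op_def truncate_def volterra_def fun_eq_iff distrib_left
              intro!: integral_add int)
    next
      fix c u assume "u \<in> C_space a b"
      show "volterra_op a b f (\<lambda>x. c * u x) = (\<lambda>x. c * volterra_op a b f u x)"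
        by (auto simp: volterra_op_def truncate_def volterra_def fun_eq_iff mult.left_commute[of _ c])
    qed
  next
    fix L c u x
    assume L: "L \<ge> (1::real)" and u: "u \<in> C_space a b"
      and bound: "\<And>z. z \<in> {a..b} \<Longrightarrow> norm (u z) \<le> c * exp (L * (z - a))"
      and x: "x \<in> {a..b}" and "c \<ge> 0"
    let ?G = "\<lambda>z. M * c / L * exp (L * (z - a))"
    have G: "((\<lambda>z. M * c * exp (L * (z - a))) has_integral ?G x - ?G a) {a..x}"
      using x L
      by (intro fundamental_theorem_of_calculus)
        (auto intro!: derivative_eq_intros simp flip: has_real_derivative_iff_has_vector_derivative)
    have "norm (integral {a..x} (\<lambda>z. f (x, z) * u z)) \<le>
        integral {a..x} (\<lambda>z. M * c * exp (L * (z - a)))"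
    proof (rule integral_norm_bound_integral[OF int[OF u x] has_integral_integrable[OF G]])
      fix z assume z: "z \<in> {a..x}"
      then have "norm (f (x, z)) \<le> M" "norm (u z) \<le> c * exp (L * (z - a))"
        using x by (auto intro!: M(2) bound simp: triangle_def)
      then show "norm (f (x, z) * u z) \<le> M * c * exp (L * (z - a))"
        unfolding norm_mult mult.assoc using M(1) by (intro mult_mono) auto
    qed
    also have "\<dots> = ?G x - ?G a"
      using G by (rule integral_unique)
    also have "\<dots> \<le> ?G x"
      using M(1) L \<open>c \<ge> 0\<close> by simp
    finally show "norm (volterra_op a b f u x) \<le> M / L * c * exp (L * (x - a))"
      using x by (simp add: volterra_op_def volterra_def)
  qed (use M in auto)
qed

section \<open>Iterated antiderivatives\<close>

abbreviation antideriv :: "real \<Rightarrow> real \<Rightarrow> (real \<Rightarrow> complex) \<Rightarrow> real \<Rightarrow> complex" where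
  "antideriv a b \<equiv> volterra_op a b (\<lambda>_. 1)"

lemma volterra_type_antideriv: "volterra_type a b (antideriv a b)"
  by (rule volterra_type_volterra_op) (rule continuous_on_const)

lemma volterra_type_antideriv_power: "volterra_type a b ((antideriv a b ^^ Suc m))"
proof (induction m)
  case 0
  then show ?case by (simp add: volterra_type_antideriv)
next
  case (Suc m)
  from volterra_type_comp[OF this volterra_type_antideriv] show ?case
    by (simp add: comp_def)
qed

lemma antideriv_power_in_C_space: "u \<in> C_space a b \<Longrightarrow> (antideriv a b ^^ m) u \<in> C_space a b"
  by (induction m) (auto intro: linear_mapD(1)[OF volterra_type_linear[OF volterra_type_antideriv]])

lemma antideriv_has_vector_derivative:
  assumes "u \<in> C_space a b" "x \<in> {a..b}"
  shows "(antideriv a b u has_vector_derivative u x) (at x within {a..b})"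
  by (rule has_vector_derivative_transform[OF assms(2) _
        integral_has_vector_derivative[OF C_spaceD(1)[OF assms(1)] assms(2)]])
    (simp add: volterra_op_def volterra_def)

lemma Dx_antideriv_power:
  assumes "a < b" and u: "u \<in> C_space a b" and "i \<le> n" "x \<in> {a..b}"
  shows "Dx a b i ((antideriv a b ^^ n) u) x = (antideriv a b ^^ (n - i)) u x"
  using assms(3,4)
proof (induction i arbitrary: x)
  case 0
  then show ?case by simp
next
  case (Suc i)
  let ?v = "(antideriv a b ^^ (n - Suc i)) u"
  have "n - i = Suc (n - Suc i)"
    using Suc.prems by simp
  then have "Dx a b i ((antideriv a b ^^ n) u) y = antideriv a b ?v y" if "y \<in> {a..b}" for y
    using Suc that by simp
  then have "(Dx a b i ((antideriv a b ^^ n) u) has_vector_derivative ?v x) (at x within {a..b})"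
    using has_vector_derivative_transform[OF Suc.prems(2) _
        antideriv_has_vector_derivative[OF antideriv_power_in_C_space[OF u] Suc.prems(2)]]
    by blast
  then show ?case
    using \<open>a < b\<close> Suc.prems(2) by (simp add: vector_derivative_within_cbox[of a b, simplified])
qed

lemma antideriv_at_left_endpoint: "antideriv a b u a = 0"
  by (simp add: volterra_op_def truncate_def volterra_def)

lemma antideriv_power_in_D_space:
  assumes "a < b" and u: "u \<in> C_space a b"
  shows "(antideriv a b ^^ n) u \<in> D_space n a b"
proof -
  let ?\<phi> = "(antideriv a b ^^ n) u"
  have cont: "continuous_on {a..b} (Dx a b i ?\<phi>)" if "i \<le> n" for i
    using C_spaceD(1)[OF antideriv_power_in_C_space[OF u, of "n - i"]] that
    by (subst continuous_on_cong[OF refl Dx_antideriv_power[OF assms]])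
  have lower: "n - i = Suc (n - Suc i)" if "i < n" for i
    using that by simp
  have diff: "Dx a b i ?\<phi> differentiable (at x within {a..b})" if "i < n" "x \<in> {a..b}" for i x
  proof -
    let ?v = "(antideriv a b ^^ (n - Suc i)) u"
    have "Dx a b i ?\<phi> y = antideriv a b ?v y" if "y \<in> {a..b}" for y
      using Dx_antideriv_power[OF assms _ that, of i n] lower[OF \<open>i < n\<close>] \<open>i < n\<close> by simp
    then have "(Dx a b i ?\<phi> has_vector_derivative ?v x) (at x within {a..b})"
      using has_vector_derivative_transform[OF that(2) _
          antideriv_has_vector_derivative[OF antideriv_power_in_C_space[OF u] that(2)]]
      by blast
    then show ?thesis
      by (rule differentiableI_vector)
  qed
  have "Dx a b i ?\<phi> a = 0" if "i < n" for i
    using Dx_antideriv_power[OF assms, of i n a] lower[OF that] that \<open>a < b\<close>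
    by (simp add: antideriv_at_left_endpoint)
  then show ?thesis
    using cont diff C_spaceD(2)[OF antideriv_power_in_C_space[OF u]]
    unfolding D_space_def times_cont_diff_def by blast
qed

lemma D_spaceD:
  assumes "\<phi> \<in> D_space n a b"
  shows "i < n \<Longrightarrow> x \<in> {a..b} \<Longrightarrow> Dx a b i \<phi> differentiable (at x within {a..b})"
    and "i \<le> n \<Longrightarrow> continuous_on {a..b} (Dx a b i \<phi>)"
    and "i < n \<Longrightarrow> Dx a b i \<phi> a = 0"
    and "x \<notin> {a..b} \<Longrightarrow> \<phi> x = 0"
  using assms unfolding D_space_def times_cont_diff_def by blast+

lemma truncate_Dx_in_C_space: "\<phi> \<in> D_space n a b \<Longrightarrow> i \<le> n \<Longrightarrow> truncate a b (Dx a b i \<phi>) \<in> C_space a b"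
  by (simp add: truncate_in_C_space_iff D_spaceD)

text \<open>
  The fundamental theorem of calculus; the boundary term vanishes by the conditions at \<open>a\<close> in the
  definition of \<open>D\<^sup>n[a,b]\<close>.
\<close>

lemma truncate_Dx_eq_antideriv:
  assumes \<phi>: "\<phi> \<in> D_space n a b" and "i < n"
  shows "truncate a b (Dx a b i \<phi>) = antideriv a b (truncate a b (Dx a b (Suc i) \<phi>))"
proof
  fix x
  show "truncate a b (Dx a b i \<phi>) x = antideriv a b (truncate a b (Dx a b (Suc i) \<phi>)) x"
  proof (cases "x \<in> {a..b}")
    case True
    have "(Dx a b (Suc i) \<phi> has_integral Dx a b i \<phi> x - Dx a b i \<phi> a) {a..x}"
    proof (rule fundamental_theorem_of_calculus)
      fix z assume z: "z \<in> {a..x}"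
      then have "(Dx a b i \<phi> has_vector_derivative Dx a b (Suc i) \<phi> z) (at z within {a..b})"
        using D_spaceD(1)[OF \<phi> \<open>i < n\<close>, of z] True by (simp add: vector_derivative_works)
      then show "(Dx a b i \<phi> has_vector_derivative Dx a b (Suc i) \<phi> z) (at z within {a..x})"
        by (rule has_vector_derivative_within_subset) (use True in auto)
    qed (use True in auto)
    then have "integral {a..x} (Dx a b (Suc i) \<phi>) = Dx a b i \<phi> x"
      using D_spaceD(3)[OF \<phi> \<open>i < n\<close>] by (simp add: integral_unique)
    moreover have "integral {a..x} (truncate a b (Dx a b (Suc i) \<phi>)) = integral {a..x} (Dx a b (Suc i) \<phi>)"
      using True by (intro integral_cong truncate_in) auto
    ultimately show ?thesis
      using True by (simp add: volterra_op_def volterra_def)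
  qed (simp add: volterra_op_def)
qed

lemma truncate_Dx_eq_antideriv_power:
  assumes \<phi>: "\<phi> \<in> D_space n a b" and "i \<le> n"
  shows "truncate a b (Dx a b i \<phi>) = (antideriv a b ^^ (n - i)) (truncate a b (Dx a b n \<phi>))"
  using \<open>i \<le> n\<close>
proof (induction i rule: inc_induct)
  case base
  then show ?case by simp
next
  case (step i)
  then have "n - i = Suc (n - Suc i)"
    by simp
  then show ?case
    using truncate_Dx_eq_antideriv[OF \<phi>, of i] step by simp
qed

lemma antideriv_power_Dx:
  assumes \<phi>: "\<phi> \<in> D_space n a b"
  shows "(antideriv a b ^^ n) (truncate a b (Dx a b n \<phi>)) = \<phi>"
proof -
  have "truncate a b \<phi> = \<phi>"
    using D_spaceD(4)[OF \<phi>] by (auto simp: truncate_def)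
  then show ?thesis
    using truncate_Dx_eq_antideriv_power[OF \<phi>, of 0] by simp
qed

lemma bij_betw_antideriv_power:
  assumes "a < b"
  shows "bij_betw (antideriv a b ^^ n) (C_space a b) (D_space n a b)"
proof (rule bij_betw_byWitness[where f' = "\<lambda>\<phi>. truncate a b (Dx a b n \<phi>)"])
  show "\<forall>u\<in>C_space a b. truncate a b (Dx a b n ((antideriv a b ^^ n) u)) = u"
  proof
    fix u assume u: "u \<in> C_space a b"
    then show "truncate a b (Dx a b n ((antideriv a b ^^ n) u)) = u"
      using Dx_antideriv_power[OF assms u, of n n] C_spaceD(2)[OF u]
      by (auto simp: truncate_def fun_eq_iff)
  qed
qed (use antideriv_power_Dx antideriv_power_in_D_space[OF assms] truncate_Dx_in_C_space in auto)

section \<open>The two invertibility statements\<close>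

text \<open>\<open>G\<close> is \<open>1 + m\<^sup>-\<^sup>1 T\<close> followed by multiplication by \<open>m\<close>.\<close>

lemma second_kind_operator:
  assumes "a < b" and m: "continuous_on {a..b} m" "\<And>x. x \<in> {a..b} \<Longrightarrow> m x \<noteq> 0"
    and T: "volterra_type a b T"
  defines "G \<equiv> \<lambda>u x. m x * u x + T u x"
  shows "linear_map (C_space a b) (C_space a b) G" and "bij_betw G (C_space a b) (C_space a b)"
proof -
  note lin = T[THEN volterra_type_linear]
  show "linear_map (C_space a b) (C_space a b) G"
    using lin unfolding linear_map_def G_def
    by (auto simp: distrib_left ac_simps intro!: C_space_add C_space_mult[OF m(1), unfolded mult.commute[of "m _"]])
  let ?S = "\<lambda>u x. inverse (m x) * T u x"
  have S: "volterra_type a b ?S"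
    using m by (intro volterra_type_mult T continuous_intros) auto
  have "bij_betw ((\<lambda>u x. m x * u x) \<circ> (\<lambda>u x. u x + ?S u x)) (C_space a b) (C_space a b)"
    using bij_betw_add_volterra_type[OF \<open>a < b\<close> S] bij_betw_mult_C_space[OF m]
    by (rule bij_betw_trans)
  moreover have "((\<lambda>u x. m x * u x) \<circ> (\<lambda>u x. u x + ?S u x)) u = G u" if u: "u \<in> C_space a b" for u
    using m(2) C_spaceD(2)[OF u] C_spaceD(2)[OF linear_mapD(1)[OF lin u]]
    by (fastforce simp: G_def fun_eq_iff field_simps)
  ultimately show "bij_betw G (C_space a b) (C_space a b)"
    by (simp cong: bij_betw_cong)
qed

theorem invertible_j_op:
  assumes "a < b" and P: "continuous_on {a..b} P" "\<And>x. x \<in> {a..b} \<Longrightarrow> P x \<noteq> 0"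
    and f: "continuous_on (triangle a b) f"
  shows "invertible_linear_map (C_space a b) (C_space a b) (j_op a b P f)"
proof (rule invertible_linear_map_if_parametrised[where J = "\<lambda>u. u"])
  have "volterra_type a b (\<lambda>u x. - 1 * volterra_op a b f u x)"
    by (intro volterra_type_mult volterra_type_volterra_op f continuous_on_const)
  note G = second_kind_operator[OF \<open>a < b\<close> P this]
  show "linear_map (C_space a b) (C_space a b) (\<lambda>u x. P x * u x + - 1 * volterra_op a b f u x)"
    by (rule G(1))
  show "bij_betw (\<lambda>u x. P x * u x + - 1 * volterra_op a b f u x) (C_space a b) (C_space a b)"
    by (rule G(2))
  fix u assume "u \<in> C_space a b"
  then show "j_op a b P f u = (\<lambda>x. P x * u x + - 1 * volterra_op a b f u x)"
    using C_spaceD(2) by (auto simp: j_op_def volterra_op_def truncate_def fun_eq_iff)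
qed (auto simp: linear_map_def bij_betw_def intro: C_space_add C_space_scale)

text \<open>
  The \<open>i\<close>-th derivative of \<open>J\<^sup>n u\<close> is \<open>J\<^sup>n\<^sup>-\<^sup>i u\<close>, which involves at least one integration for \<open>i < n\<close>;
  so every term of \<open>k (J\<^sup>n u)\<close> except the leading one is of Volterra type in \<open>u\<close>.
\<close>

theorem invertible_k_op:
  assumes "a < b" and "n \<ge> 1" and p: "\<And>i. i \<le> n \<Longrightarrow> continuous_on {a..b} (p i)"
    and "\<And>x. x \<in> {a..b} \<Longrightarrow> p n x \<noteq> 0"
    and f: "continuous_on (triangle a b) f"
  shows "invertible_linear_map (D_space n a b) (C_space a b) (k_op a b n p f)"
proof (rule invertible_linear_map_if_parametrised)
  let ?J = "antideriv a b"
  define T where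
    "T u x = (\<Sum>i<n. p i x * (?J ^^ (n - i)) u x) + volterra_op a b f ((?J ^^ n) u) x" for u x
  have J: "volterra_type a b (?J ^^ m)" if "m \<ge> 1" for m
    using volterra_type_antideriv_power[of a b "m - 1"] that by simp
  have T: "volterra_type a b T"
    unfolding T_def using \<open>n \<ge> 1\<close>
    by (intro volterra_type_add volterra_type_sum volterra_type_mult p J
          volterra_type_comp[OF J] volterra_type_volterra_op f) auto
  note G = second_kind_operator[OF \<open>a < b\<close> p[OF order_refl] assms(4) T]
  show "linear_map (C_space a b) (C_space a b) (\<lambda>u x. p n x * u x + T u x)"
    by (rule G(1))
  show "bij_betw (\<lambda>u x. p n x * u x + T u x) (C_space a b) (C_space a b)"
    by (rule G(2))
  show bij: "bij_betw (?J ^^ n) (C_space a b) (D_space n a b)"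
    by (rule bij_betw_antideriv_power[OF \<open>a < b\<close>])
  show "linear_map (C_space a b) (D_space n a b) (?J ^^ n)"
    using volterra_type_linear[OF J[OF \<open>n \<ge> 1\<close>]] bij_betwE[OF bij] unfolding linear_map_def by blast
  fix u assume u: "u \<in> C_space a b"
  show "k_op a b n p f ((?J ^^ n) u) = (\<lambda>x. p n x * u x + T u x)"
  proof
    fix x
    show "k_op a b n p f ((?J ^^ n) u) x = p n x * u x + T u x"
    proof (cases "x \<in> {a..b}")
      case True
      have "(\<Sum>i=1..n. p i x * Dx a b i ((?J ^^ n) u) x) + p 0 x * (?J ^^ n) u x
          = (\<Sum>i\<le>n. p i x * (?J ^^ (n - i)) u x)"
        using Dx_antideriv_power[OF \<open>a < b\<close> u _ True, of _ n]
        by (simp add: sum.atLeast1_atMost_eq sum.atMost_shift Suc_le_eq)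
      also have "\<dots> = (\<Sum>i<n. p i x * (?J ^^ (n - i)) u x) + p n x * u x"
        by (simp add: lessThan_Suc_atMost[symmetric])
      finally show ?thesis
        using True by (simp add: k_op_def T_def volterra_op_def algebra_simps)
    next
      case False
      then show ?thesis
        using C_spaceD(2)[OF u] C_spaceD(2)[OF linear_mapD(1)[OF volterra_type_linear[OF T] u]]
        by (auto simp: k_op_def)
    qed
  qed
qed (auto intro: C_space_add C_space_scale)

theorem proposition5:
  fixes a b :: real
    and n :: nat
    and P :: "real \<Rightarrow> complex"
    and p :: "nat \<Rightarrow> real \<Rightarrow> complex"
    and f :: "real \<times> real \<Rightarrow> complex"
  assumes "a < b"
    and "n \<ge> 1"
    and "P \<in> B1 a b"
    and "\<forall>i\<le>n. p i \<in> B1 a b"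
    and "f \<in> B2 a b"
  shows "((\<forall>x\<in>{a..b}. P x \<noteq> 0) \<longrightarrow>
            invertible_linear_map (C_space a b) (C_space a b) (j_op a b P f)) \<and>
         ((\<forall>x\<in>{a..b}. p n x \<noteq> 0) \<longrightarrow>
            invertible_linear_map (D_space n a b) (C_space a b) (k_op a b n p f))"
proof -
  have cont: "continuous_on {a..b} Q" if "Q \<in> B1 a b" for Q
    using that unfolding B1_def times_cont_diff_def by (auto dest: spec[of _ 0])
  have "Ck_triangle a b 0 f"
    using assms(5) unfolding B2_def by blast
  then have f: "continuous_on (triangle a b) f"
    by simp
  show ?thesis
    using invertible_j_op[OF assms(1) cont[OF assms(3)] _ f]
      invertible_k_op[where p = p, OF assms(1,2) cont _ f] assms(4) by blast
qed

end
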